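(* Let $n\ge1$ and let $\alpha(t)=\frac{r}{\cosh t}$, where $r>0$ is a constant. Then $\alpha\in\hat{\Psi}$ and $dS_{n+1}(f_\alpha)$ is a timelike hypersurface isometric to $\mathbb{R}\times S^n$ with metric $$g=-\frac{r^2}{\cosh^4 t}\,dt\otimes dt+r^2\,\Omega_n.$$
   Context: $\mathbb{R}^{n+2}_1$ is $\mathbb{R}^{n+2}$ with metric $\eta=-dx^0\otimes dx^0+dx^1\otimes dx^1+\cdots+dx^{n+1}\otimes dx^{n+1}$. For a smooth function $f:(a,b)\to\mathbb{R}$ on an open interval (possibly unbounded), $dS_{n+1}(f)$ is the hypersurface $\{x\in\mathbb{R}^{n+2}_1 : x^0\in(a,b),\ -(x^0)^2+(x^1)^2+\cdots+(x^{n+1})^2=f(x^0)^2\}$ with the metric induced from $\eta$. $\Psi$ is the set of smooth functions $\alpha:\mathbb{R}\to\mathbb{R}$ with $\alpha(t)>0$ for all $t$ and such that $h(t):=\alpha(t)\sinh t$ has nonzero derivative for all $t$. $\hat{\Psi}$ is the set of $\alpha\in\Psi$ with $|\alpha'(t)|\neq\alpha(t)$ for all $t$. For $\alpha\in\Psi$, $f_\alpha:=\alpha\circ h^{-1}$ on the open interval $h(\mathbb{R})$. $\Omega_n$ denotes the round metric on the unit sphere $S^n$, and also its pullback to $\mathbb{R}\times S^n$ under the projection to $S^n$; $t$ is the coordinate on $\mathbb{R}$. A hypersurface is timelike if its normal at every point is a spacelike vector ($\eta(v,v)>0$); equivalently, the induced metric is Lorentzian. *)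

theory Defs
  imports "HOL-Analysis.Analysis"
begin

section \<open>Smooth functions and submanifolds of Euclidean space\<close>

text \<open>
  \<open>S\<close> is meant to be open.  Requiring all directional derivatives to be \<open>C\<^sup>k\<close> is, in finite
  dimension, the same as requiring the derivative to be a \<open>C\<^sup>k\<close> map into the linear maps.
\<close>
primrec Ck_on :: "nat \<Rightarrow> 'a::euclidean_space set \<Rightarrow> ('a \<Rightarrow> 'b::euclidean_space) \<Rightarrow> bool" where
  "Ck_on 0 S f \<longleftrightarrow> continuous_on S f"
| "Ck_on (Suc k) S f \<longleftrightarrow>
     (\<forall>x\<in>S. f differentiable (at x)) \<and>
     (\<forall>v. Ck_on k S (\<lambda>x. frechet_derivative f (at x) v))"

definition smooth_on :: "'a::euclidean_space set \<Rightarrow> ('a \<Rightarrow> 'b::euclidean_space) \<Rightarrow> bool" where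
  "smooth_on S f \<longleftrightarrow> (\<forall>k. Ck_on k S f)"

definition smooth_hypersurface :: "'a::euclidean_space set \<Rightarrow> bool" where
  "smooth_hypersurface M \<longleftrightarrow>
     (\<forall>p\<in>M. \<exists>U (F :: 'a \<Rightarrow> real). open U \<and> p \<in> U \<and> smooth_on U F \<and>
        M \<inter> U = {x \<in> U. F x = 0} \<and>
        (\<forall>x\<in>M \<inter> U. frechet_derivative F (at x) \<noteq> (\<lambda>v. 0)))"

text \<open>
  Tangent vectors of a subset of Euclidean space are the velocities of smooth curves in it; for an
  embedded submanifold this is the usual tangent space, regarded as a subspace of the ambient space.
\<close>
definition tangent_space :: "'a::euclidean_space set \<Rightarrow> 'a \<Rightarrow> 'a set" where
  "tangent_space M p =
     {v. \<exists>c e. e > 0 \<and> smooth_on {-e<..<e} c \<and> c ` {-e<..<e} \<subseteq> M \<and> c 0 = p \<and>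
           (c has_vector_derivative v) (at (0::real))}"

definition local_smooth_extension ::
    "'a::euclidean_space set \<Rightarrow> ('a \<Rightarrow> 'b::euclidean_space) \<Rightarrow> 'a \<Rightarrow> ('a \<Rightarrow> 'b) \<Rightarrow> bool" where
  "local_smooth_extension M f p F \<longleftrightarrow>
     (\<exists>U. open U \<and> p \<in> U \<and> smooth_on U F \<and> (\<forall>x\<in>M \<inter> U. F x = f x))"

definition smooth_map :: "'a::euclidean_space set \<Rightarrow> ('a \<Rightarrow> 'b::euclidean_space) \<Rightarrow> bool" where
  "smooth_map M f \<longleftrightarrow> (\<forall>p\<in>M. \<exists>F. local_smooth_extension M f p F)"

text \<open>
  Meaningful only on \<open>tangent_space M p\<close>, where, by the chain rule along curves in \<open>M\<close>,
  it does not depend on the chosen extension.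
\<close>
definition differential ::
    "'a::euclidean_space set \<Rightarrow> ('a \<Rightarrow> 'b::euclidean_space) \<Rightarrow> 'a \<Rightarrow> 'a \<Rightarrow> 'b" where
  "differential M f p = frechet_derivative (SOME F. local_smooth_extension M f p F) (at p)"

definition diffeomorphism ::
    "'a::euclidean_space set \<Rightarrow> 'b::euclidean_space set \<Rightarrow> ('a \<Rightarrow> 'b) \<Rightarrow> bool" where
  "diffeomorphism M N f \<longleftrightarrow>
     bij_betw f M N \<and> smooth_map M f \<and> smooth_map N (inv_into M f)"

text \<open>
  A metric on \<open>M\<close> is given by a family of bilinear forms on the ambient space, indexed by the base
  point; only its values on tangent vectors of \<open>M\<close> matter, so a form on the ambient space also
  stands for the metric it induces on \<open>M\<close>.
\<close>
type_synonym 'a metric_tensor = "'a \<Rightarrow> 'a \<Rightarrow> 'a \<Rightarrow> real"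

definition isometric ::
    "'a::euclidean_space set \<Rightarrow> 'a metric_tensor \<Rightarrow> 'b::euclidean_space set \<Rightarrow> 'b metric_tensor \<Rightarrow> bool"
  where
  "isometric M g N g' \<longleftrightarrow>
     (\<exists>\<phi>. diffeomorphism M N \<phi> \<and>
        (\<forall>p\<in>M. \<forall>u\<in>tangent_space M p. \<forall>v\<in>tangent_space M p.
           g' (\<phi> p) (differential M \<phi> p u) (differential M \<phi> p v) = g p u v))"


section \<open>Minkowski space\<close>

text \<open>
  A point of Minkowski space is a pair of its time coordinate \<open>x\<^sup>0\<close> and its vector of space
  coordinates; for \<open>CARD('m) = n + 1\<close> this is the Minkowski space of dimension \<open>n + 2\<close>.
\<close>
type_synonym 'm minkowski = "real \<times> (real ^ 'm)"

definition eta :: "'m::finite minkowski metric_tensor" where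
  "eta p u v = - (fst u * fst v) + (\<Sum>i\<in>UNIV. snd u $ i * snd v $ i)"

definition timelike_hypersurface :: "'m::finite minkowski set \<Rightarrow> bool" where
  "timelike_hypersurface M \<longleftrightarrow>
     smooth_hypersurface M \<and>
     (\<forall>p\<in>M. \<forall>v. v \<noteq> 0 \<and> (\<forall>u\<in>tangent_space M p. eta p v u = 0) \<longrightarrow> eta p v v > 0)"

text \<open>\<open>I\<close> is the open interval on which \<open>f\<close> is defined; values of \<open>f\<close> outside \<open>I\<close> are irrelevant.\<close>
definition dS :: "real set \<Rightarrow> (real \<Rightarrow> real) \<Rightarrow> 'm::finite minkowski set" where
  "dS I f = {x. fst x \<in> I \<and> - (fst x)\<^sup>2 + (\<Sum>i\<in>UNIV. (snd x $ i)\<^sup>2) = (f (fst x))\<^sup>2}"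


section \<open>The functions parametrising the hypersurfaces\<close>

definition h_of :: "(real \<Rightarrow> real) \<Rightarrow> real \<Rightarrow> real" where
  "h_of \<alpha> t = \<alpha> t * sinh t"

definition Psi :: "(real \<Rightarrow> real) set" where
  "Psi = {\<alpha>. smooth_on UNIV \<alpha> \<and> (\<forall>t. \<alpha> t > 0) \<and> (\<forall>t. deriv (h_of \<alpha>) t \<noteq> 0)}"

definition Psi_hat :: "(real \<Rightarrow> real) set" where
  "Psi_hat = {\<alpha> \<in> Psi. \<forall>t. \<bar>deriv \<alpha> t\<bar> \<noteq> \<alpha> t}"

text \<open>To be used on \<open>range (h_of \<alpha>)\<close> only.\<close>
definition f_of :: "(real \<Rightarrow> real) \<Rightarrow> real \<Rightarrow> real" where
  "f_of \<alpha> = \<alpha> \<circ> inv (h_of \<alpha>)"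


section \<open>The product of the line with the unit sphere\<close>

definition line_times_sphere :: "(real \<times> (real ^ 'm::finite)) set" where
  "line_times_sphere = UNIV \<times> sphere 0 1"

definition dt_dt :: "(real \<times> (real ^ 'm::finite)) metric_tensor" where
  "dt_dt p u v = fst u * fst v"

definition round_metric :: "(real ^ 'm::finite) metric_tensor" where
  "round_metric x u v = u \<bullet> v"

text \<open>The projection to the sphere is the restriction of the linear map \<open>snd\<close>, so its differential is
  \<open>snd\<close> as well.\<close>
definition pulled_back_round_metric :: "(real \<times> (real ^ 'm::finite)) metric_tensor" where
  "pulled_back_round_metric p u v = round_metric (snd p) (snd u) (snd v)"

end

theory Submission imports Defs begin

text \<open>
  For \<open>\<alpha> = r / cosh\<close> one has \<open>h = r tanh\<close>, a diffeomorphism from the line onto the interval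
  \<open>(-r, r)\<close>, and \<open>\<alpha>\<^sup>2 = r\<^sup>2 - h\<^sup>2\<close>.  So \<open>f\<^sub>\<alpha>(s)\<^sup>2 = r\<^sup>2 - s\<^sup>2\<close>, and the term \<open>-s\<^sup>2\<close> cancels from the
  equation of the hypersurface: it is the straight cylinder over the sphere of radius \<open>r\<close>, of
  height \<open>(-r, r)\<close> along the time axis.

  The time axis is then tangent everywhere.  A normal vector is therefore orthogonal to it, hence
  purely spatial, hence spacelike.

  The induced metric of the cylinder is \<open>-ds\<^sup>2\<close> plus the metric of the sphere of radius \<open>r\<close>, which
  is \<open>r\<^sup>2\<close> times the round metric; the reparametrisation \<open>s = r tanh t\<close> gives \<open>ds = (r / cosh\<^sup>2 t) dt\<close>
  and hence the asserted metric.  The isometry is \<open>(s, y) \<mapsto> (artanh (s / r), y / r)\<close>.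

  The differential of a map on a submanifold is defined by an unspecified local extension; the chain
  rule along the curves that define tangent vectors lets any convenient extension replace it.  The
  smoothness of \<open>tanh\<close>, \<open>1 / cosh\<close> and \<open>artanh\<close> rests on differential equations that express the
  derivatives of these functions polynomially in functions already treated.
\<close>

section \<open>Calculus of smooth functions\<close>

lemma Ck_on_cong:
  assumes "open S" "\<And>x. x \<in> S \<Longrightarrow> f x = g x"
  shows "Ck_on k S f \<Longrightarrow> Ck_on k S g"
  using assms(2)
proof (induction k arbitrary: f g)
  case 0
  then show ?case by (metis Ck_on.simps(1) continuous_on_cong)
next
  case (Suc k)
  have D: "(g has_derivative frechet_derivative f (at x)) (at x)" if "x \<in> S" for x
  proof (rule has_derivative_transform_within_open[OF _ \<open>open S\<close> that])
    show "(f has_derivative frechet_derivative f (at x)) (at x)"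
      using Suc.prems(1) that frechet_derivative_works by auto
  qed (use Suc.prems(2) in auto)
  have "Ck_on k S (\<lambda>x. frechet_derivative g (at x) v)" for v
  proof (rule Suc.IH)
    show "Ck_on k S (\<lambda>x. frechet_derivative f (at x) v)" using Suc.prems(1) by simp
    show "frechet_derivative f (at x) v = frechet_derivative g (at x) v" if "x \<in> S" for x
      using frechet_derivative_at[OF D[OF that]] by simp
  qed
  with D show ?case by (auto simp: differentiable_def)
qed

text \<open>Lets the derivative be given by a formula, whose value outside \<open>S\<close> is arbitrary.\<close>
lemma Ck_on_SucI:
  assumes "open S" "\<And>x. x \<in> S \<Longrightarrow> (f has_derivative f' x) (at x)"
    and "\<And>v. Ck_on k S (\<lambda>x. f' x v)"
  shows "Ck_on (Suc k) S f"
proof -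
  have "Ck_on k S (\<lambda>x. frechet_derivative f (at x) v)" for v
    by (rule Ck_on_cong[OF \<open>open S\<close> _ assms(3)[of v]])
       (use frechet_derivative_at[OF assms(2)] in auto)
  with assms(2) show ?thesis by (auto simp: differentiable_def)
qed

lemma Ck_on_SucD:
  assumes "Ck_on (Suc k) S f"
  shows "x \<in> S \<Longrightarrow> (f has_derivative frechet_derivative f (at x)) (at x)"
    and "Ck_on k S (\<lambda>x. frechet_derivative f (at x) v)"
  using assms frechet_derivative_works by auto

lemma Ck_on_Suc_imp_Ck_on: "Ck_on (Suc k) S f \<Longrightarrow> Ck_on k S f"
proof (induction k arbitrary: f)
  case 0
  then show ?case
    by (auto intro!: continuous_at_imp_continuous_on differentiable_imp_continuous_within)
next
  case (Suc k)
  then show ?case by (metis Ck_on.simps(2))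
qed

lemma Ck_on_const: "open S \<Longrightarrow> Ck_on k S (\<lambda>x. c)"
proof (induction k arbitrary: c)
  case (Suc k)
  show ?case
    by (rule Ck_on_SucI[where f' = "\<lambda>_ _. 0"]) (use Suc in \<open>auto intro: derivative_intros\<close>)
qed auto

lemma Ck_on_linear:
  assumes "open S" "bounded_linear L"
  shows "Ck_on k S L"
proof (cases k)
  case 0
  then show ?thesis using assms by (simp add: bounded_linear.linear linear_continuous_on)
next
  case (Suc m)
  then show ?thesis
    using assms by (auto intro!: Ck_on_SucI[where f' = "\<lambda>_. L"] bounded_linear_imp_has_derivative
        Ck_on_const simp del: Ck_on.simps)
qed

lemma Ck_on_add:
  assumes "open S"
  shows "Ck_on k S f \<Longrightarrow> Ck_on k S g \<Longrightarrow> Ck_on k S (\<lambda>x. f x + g x)"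
proof (induction k arbitrary: f g)
  case 0
  then show ?case by (simp add: continuous_on_add)
next
  case (Suc k)
  show ?case
    by (rule Ck_on_SucI[OF \<open>open S\<close> has_derivative_add[OF Ck_on_SucD(1)[OF Suc.prems(1)]
        Ck_on_SucD(1)[OF Suc.prems(2)]]])
       (auto intro!: Suc.IH Ck_on_SucD(2) Suc.prems simp del: Ck_on.simps)
qed

lemma Ck_on_bilinear:
  assumes "open S" "bounded_bilinear B"
  shows "Ck_on k S f \<Longrightarrow> Ck_on k S g \<Longrightarrow> Ck_on k S (\<lambda>x. B (f x) (g x))"
proof (induction k arbitrary: f g)
  case 0
  then show ?case using bounded_bilinear.continuous_on[OF assms(2)] by auto
next
  case (Suc k)
  have "Ck_on k S (\<lambda>x. B (f x) (frechet_derivative g (at x) v)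
      + B (frechet_derivative f (at x) v) (g x))" for v
    by (rule Ck_on_add[OF \<open>open S\<close> Suc.IH Suc.IH])
       (rule Ck_on_Suc_imp_Ck_on Ck_on_SucD(2), rule Suc.prems)+
  with \<open>open S\<close> bounded_bilinear.FDERIV[OF assms(2) Ck_on_SucD(1)[OF Suc.prems(1)]
      Ck_on_SucD(1)[OF Suc.prems(2)]]
  show ?case by (rule Ck_on_SucI)
qed

lemmas Ck_on_mult = Ck_on_bilinear[OF _ bounded_bilinear_mult]

lemma Ck_on_Pair:
  assumes "open S"
  shows "Ck_on k S f \<Longrightarrow> Ck_on k S g \<Longrightarrow> Ck_on k S (\<lambda>x. (f x, g x))"
proof (induction k arbitrary: f g)
  case 0
  then show ?case by (simp add: continuous_on_Pair)
next
  case (Suc k)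
  show ?case
    by (rule Ck_on_SucI[OF \<open>open S\<close> has_derivative_Pair[OF Ck_on_SucD(1)[OF Suc.prems(1)]
        Ck_on_SucD(1)[OF Suc.prems(2)]]])
       (auto intro!: Suc.IH Ck_on_SucD(2) Suc.prems simp del: Ck_on.simps)
qed

text \<open>
  Differentiating \<open>f \<circ> L\<close> in direction \<open>v\<close> gives the derivative of \<open>f\<close> in the fixed direction \<open>L v\<close>,
  composed with \<open>L\<close> again, so the induction stays within compositions with \<open>L\<close>.
\<close>
lemma Ck_on_compose_linear:
  assumes "open S" "bounded_linear L" "L ` S \<subseteq> T"
  shows "Ck_on k T f \<Longrightarrow> Ck_on k S (\<lambda>x. f (L x))"
proof (induction k arbitrary: f)
  case 0
  then show ?case
    using assms continuous_on_compose2[of T f S L] linear_continuous_on[OF assms(2)] by simp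
next
  case (Suc k)
  show ?case
  proof (rule Ck_on_SucI[OF \<open>open S\<close>])
    show "((\<lambda>x. f (L x)) has_derivative (\<lambda>v. frechet_derivative f (at (L x)) (L v))) (at x)"
      if "x \<in> S" for x
      by (rule has_derivative_compose[OF bounded_linear_imp_has_derivative[OF assms(2)]])
         (use Ck_on_SucD(1)[OF Suc.prems] assms(3) that in auto)
    show "Ck_on k S (\<lambda>x. frechet_derivative f (at (L x)) (L v))" for v
      by (rule Suc.IH[OF Ck_on_SucD(2)[OF Suc.prems]])
  qed
qed

lemma Ck_on_real_SucI:
  fixes f :: "real \<Rightarrow> real"
  assumes "open S" "\<And>x. x \<in> S \<Longrightarrow> (f has_field_derivative f' x) (at x)" "Ck_on k S f'"
  shows "Ck_on (Suc k) S f"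
  by (rule Ck_on_SucI[OF assms(1) assms(2)[THEN has_field_derivative_imp_has_derivative]])
     (auto intro!: Ck_on_mult Ck_on_const assms simp del: Ck_on.simps)


section \<open>Smoothness of the hyperbolic functions involved\<close>

lemma one_minus_tanh_square: "1 - (tanh t)\<^sup>2 = 1 / (cosh t)\<^sup>2" for t :: real
proof -
  have "(cosh t)\<^sup>2 \<noteq> 0" by simp
  then show ?thesis
    by (simp add: tanh_def power_divide cosh_square_eq[of t] divide_simps)
qed

text \<open>By induction along the Riccati equation \<open>tanh' = 1 - tanh\<^sup>2\<close>.\<close>
lemma Ck_on_tanh: "Ck_on k UNIV (tanh :: real \<Rightarrow> real)"
proof (induction k)
  case 0
  then show ?case by (auto intro!: continuous_intros)
next
  case (Suc k)
  show ?case
  proof (rule Ck_on_real_SucI)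
    show "(tanh has_field_derivative 1 + (- 1) * (tanh x * tanh x)) (at x)" for x :: real
      by (auto intro!: derivative_eq_intros simp: power2_eq_square)
    show "Ck_on k UNIV (\<lambda>x::real. 1 + (- 1) * (tanh x * tanh x))"
      by (intro Ck_on_add Ck_on_mult Ck_on_const Suc open_UNIV)
  qed simp
qed

lemma has_field_derivative_divide_cosh:
  "((\<lambda>t. r / cosh t) has_field_derivative - (tanh t * (r / cosh t))) (at (t::real))"
  by (auto intro!: derivative_eq_intros simp: tanh_def field_simps power2_eq_square)

lemma Ck_on_divide_cosh: "Ck_on k UNIV (\<lambda>t::real. r / cosh t)"
proof (induction k)
  case 0
  then show ?case by (auto intro!: continuous_intros)
next
  case (Suc k)
  show ?case
  proof (rule Ck_on_real_SucI)
    show "((\<lambda>t. r / cosh t) has_field_derivative (- 1) * (tanh t * (r / cosh t))) (at t)"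
      for t :: real
      using has_field_derivative_divide_cosh by simp
    show "Ck_on k UNIV (\<lambda>t::real. (- 1) * (tanh t * (r / cosh t)))"
      by (intro Ck_on_mult Ck_on_const Ck_on_tanh Suc open_UNIV)
  qed simp
qed

text \<open>
  The function \<open>w = artanh' = 1 / (1 - x\<^sup>2)\<close> satisfies \<open>w' = 2 x w\<^sup>2\<close>, which again allows an induction
  with products only.
\<close>
lemma Ck_on_artanh: "Ck_on k {-1<..<1} (artanh :: real \<Rightarrow> real)"
proof (cases k)
  case 0
  then show ?thesis by (auto intro!: continuous_intros)
next
  case (Suc m)
  have nz: "1 - x\<^sup>2 \<noteq> 0" if "x \<in> {-1<..<1}" for x :: real
    using that abs_square_less_1[of x] by auto
  have w: "Ck_on m {-1<..<1} (\<lambda>x::real. 1 / (1 - x\<^sup>2))"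
  proof (induction m)
    case 0
    then show ?case using nz by (auto intro!: continuous_intros)
  next
    case (Suc m)
    show ?case
    proof (rule Ck_on_real_SucI)
      show "((\<lambda>x. 1 / (1 - x\<^sup>2)) has_field_derivative
              2 * (x * ((1 / (1 - x\<^sup>2)) * (1 / (1 - x\<^sup>2))))) (at x)"
        if "x \<in> {-1<..<1}" for x :: real
        using nz[OF that] by (auto intro!: derivative_eq_intros)
      show "Ck_on m {-1<..<1} (\<lambda>x::real. 2 * (x * ((1 / (1 - x\<^sup>2)) * (1 / (1 - x\<^sup>2)))))"
        by (intro Ck_on_mult Ck_on_const Ck_on_linear Suc bounded_linear_ident) auto
    qed simp
  qed
  show ?thesis unfolding Suc
    by (rule Ck_on_real_SucI[OF _ artanh_real_has_field_derivative w]) auto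
qed


section \<open>Maps on submanifolds and their differentials\<close>

lemma smooth_mapI:
  assumes "open U" "M \<subseteq> U" "smooth_on U F" "\<And>x. x \<in> M \<Longrightarrow> F x = f x"
  shows "smooth_map M f"
  using assms unfolding smooth_map_def local_smooth_extension_def by blast

text \<open>
  If \<open>c\<close> is a curve in \<open>M\<close> with velocity \<open>v\<close> at \<open>p\<close>, then every extension \<open>F\<close> of \<open>f\<close> agrees with \<open>f\<close>
  along \<open>c\<close>, so the derivative of \<open>F\<close> in direction \<open>v\<close> is the velocity of \<open>f \<circ> c\<close>, whichever \<open>F\<close> is.
\<close>
lemma differential_eq_derivative_of_extension:
  assumes "local_smooth_extension M f p F" "(F has_derivative F') (at p)" "v \<in> tangent_space M p"
  shows "differential M f p v = F' v"
proof -
  define G where "G = (SOME F. local_smooth_extension M f p F)"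
  have "local_smooth_extension M f p G"
    unfolding G_def using someI[of "local_smooth_extension M f p", OF assms(1)] .
  then obtain V where V: "open V" "p \<in> V" "smooth_on V G" "\<And>x. x \<in> M \<inter> V \<Longrightarrow> G x = f x"
    by (auto simp: local_smooth_extension_def)
  obtain U where U: "open U" "p \<in> U" "\<And>x. x \<in> M \<inter> U \<Longrightarrow> F x = f x"
    using assms(1) by (auto simp: local_smooth_extension_def)
  obtain c e where e: "e > 0" "smooth_on {-e<..<e} c" "c ` {-e<..<e} \<subseteq> M" "c 0 = p"
    and c: "(c has_vector_derivative v) (at 0)"
    using assms(3) by (auto simp: tangent_space_def)
  have "Ck_on (Suc 0) V G"
    using V(3) unfolding smooth_on_def by blast
  from Ck_on_SucD(1)[OF this V(2)]
  have G': "(G has_derivative frechet_derivative G (at p)) (at p)" .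
  have "continuous_on {-e<..<e} c"
    using e(2) unfolding smooth_on_def by (metis Ck_on.simps(1))
  then have op: "open ({-e<..<e} \<inter> c -` (U \<inter> V))"
    using U(1) V(1) by (intro continuous_open_preimage) auto
  have chain: "((\<lambda>t. H (c t)) has_vector_derivative H' v) (at 0)"
    if "(H has_derivative H') (at p)" for H H'
    using vector_derivative_diff_chain_within[OF c, of H H'] that e(4)
    by (auto simp: o_def intro: has_derivative_at_withinI)
  \<comment> \<open>For small \<open>t\<close> the curve lies in both domains of extension, where \<open>F\<close> and \<open>G\<close> equal \<open>f\<close> on \<open>M\<close>.\<close>
  have agree: "G (c t) = F (c t)" if "t \<in> {-e<..<e} \<inter> c -` (U \<inter> V)" for t
  proof -
    have "c t \<in> M \<inter> U" "c t \<in> M \<inter> V" using that e(3) by auto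
    then show ?thesis using U(3) V(4) by simp
  qed
  have "((\<lambda>t. F (c t)) has_vector_derivative frechet_derivative G (at p) v) (at 0)"
    by (rule has_vector_derivative_transform_within_open[OF chain[OF G'] op _ agree])
       (use e U(2) V(2) in simp_all)
  with chain[OF assms(2)] have "frechet_derivative G (at p) v = F' v"
    by (blast intro: vector_derivative_unique_at)
  then show ?thesis by (simp add: differential_def G_def)
qed


section \<open>The hypersurface is a cylinder\<close>

lemma h_of_divide_cosh: "h_of (\<lambda>t. r / cosh t) = (\<lambda>t. r * tanh t)"
  by (auto simp: h_of_def tanh_def)

text \<open>
  Both conditions on derivatives reduce to \<open>|tanh t| < 1\<close>: the derivative of \<open>h\<close> is \<open>r (1 - tanh\<^sup>2 t)\<close>, and
  \<open>\<alpha>' = - tanh t \<cdot> \<alpha>\<close>.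
\<close>
lemma divide_cosh_in_Psi_hat:
  assumes "r > 0"
  shows "(\<lambda>t. r / cosh t) \<in> Psi_hat"
proof -
  have sq: "(tanh t)\<^sup>2 < 1" for t :: real
    using tanh_real_bounds[of t] abs_square_less_1[of "tanh t"] by auto
  have "((\<lambda>t. r * tanh t) has_field_derivative r * (1 - (tanh t)\<^sup>2)) (at t)" for t
    by (auto intro!: derivative_eq_intros)
  then have "deriv (h_of (\<lambda>t. r / cosh t)) t = r * (1 - (tanh t)\<^sup>2)" for t
    unfolding h_of_divide_cosh by (rule DERIV_imp_deriv)
  then have "deriv (h_of (\<lambda>t. r / cosh t)) t \<noteq> 0" for t
    using sq[of t] assms by simp
  moreover have "\<bar>deriv (\<lambda>t. r / cosh t) t\<bar> < r / cosh t" for t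
  proof -
    have "\<bar>deriv (\<lambda>t. r / cosh t) t\<bar> = \<bar>tanh t\<bar> * (r / cosh t)"
      using DERIV_imp_deriv[OF has_field_derivative_divide_cosh] assms
      by (simp add: abs_mult)
    also have "\<dots> < 1 * (r / cosh t)"
      using tanh_real_bounds[of t] assms by (intro mult_strict_right_mono) auto
    finally show ?thesis by simp
  qed
  ultimately show ?thesis
    using assms Ck_on_divide_cosh
    by (auto simp: Psi_hat_def Psi_def smooth_on_def less_imp_neq)
qed

lemma range_scaled_tanh:
  assumes "r > 0"
  shows "range (\<lambda>t::real. r * tanh t) = {-r<..<r}"
proof (intro subset_antisym subsetI)
  fix s assume "s \<in> range (\<lambda>t::real. r * tanh t)"
  then obtain t where "s = r * tanh t" by blast
  moreover have "r * (- 1) < r * tanh t" "r * tanh t < r * 1"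
    using assms tanh_real_bounds[of t] by (intro mult_strict_left_mono; simp)+
  ultimately show "s \<in> {-r<..<r}" by simp
next
  fix s assume s: "s \<in> {-r<..<r}"
  \<comment> \<open>\<open>ln (sqrt y)\<close> is \<open>artanh (s / r)\<close>.\<close>
  define y where "y = (r + s) / (r - s)"
  have "y > 0" using s by (simp add: y_def)
  then have "tanh (ln (sqrt y)) = (y - 1) / (y + 1)"
    by (simp add: tanh_ln_real)
  also have "\<dots> = s / r"
    using s assms by (simp add: y_def field_simps)
  finally show "s \<in> range (\<lambda>t::real. r * tanh t)"
    using assms by (intro image_eqI[of _ _ "ln (sqrt y)"]) auto
qed

text \<open>
  At \<open>s = r tanh t\<close> the identity \<open>(r / cosh t)\<^sup>2 = r\<^sup>2 - (r tanh t)\<^sup>2\<close> gives \<open>f\<^sub>\<alpha>(s)\<^sup>2 = r\<^sup>2 - s\<^sup>2\<close>, and the defining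
  equation \<open>-s\<^sup>2 + |y|\<^sup>2 = f\<^sub>\<alpha>(s)\<^sup>2\<close> loses its dependence on \<open>s\<close>.
\<close>
lemma dS_divide_cosh:
  assumes "r > 0"
  shows "dS (range (h_of (\<lambda>t. r / cosh t))) (f_of (\<lambda>t. r / cosh t))
    = ({-r<..<r} \<times> sphere 0 r :: 'm::finite minkowski set)"
proof -
  have "(f_of (\<lambda>t. r / cosh t) s)\<^sup>2 = r\<^sup>2 - s\<^sup>2" if "s \<in> {-r<..<r}" for s
  proof -
    define t where "t = inv (h_of (\<lambda>t. r / cosh t)) s"
    have "s = r * tanh t"
      using f_inv_into_f[of s "\<lambda>t. r * tanh t" UNIV] that
      unfolding t_def h_of_divide_cosh range_scaled_tanh[OF assms] by simp
    moreover have "f_of (\<lambda>t. r / cosh t) s = r / cosh t"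
      by (simp add: f_of_def t_def)
    moreover have "(r / cosh t)\<^sup>2 = r\<^sup>2 * (1 - (tanh t)\<^sup>2)"
      by (simp add: one_minus_tanh_square power_divide)
    ultimately show ?thesis
      by (simp add: algebra_simps power_mult_distrib)
  qed
  moreover have "(\<Sum>i\<in>UNIV. (y $ i)\<^sup>2) = (norm y)\<^sup>2" for y :: "real ^ 'm"
    unfolding power2_norm_eq_inner by (simp add: inner_vec_def power2_eq_square)
  ultimately show ?thesis
    using assms unfolding dS_def h_of_divide_cosh range_scaled_tanh[OF assms]
    by (auto simp: power2_eq_iff_nonneg)
qed

lemma time_axis_tangent_cylinder:
  assumes "p \<in> {-r<..<r} \<times> sphere (0 :: real ^ 'm::finite) r"
  shows "(1, 0) \<in> tangent_space ({-r<..<r} \<times> sphere 0 r) p"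
proof -
  define c where "c = (\<lambda>t. (fst p + t, snd p))"
  \<comment> \<open>the distance from \<open>p\<close> to the nearer end of the cylinder\<close>
  define e where "e = r - \<bar>fst p\<bar>"
  have "smooth_on {-e<..<e} c"
    unfolding c_def smooth_on_def
    by (intro allI Ck_on_Pair Ck_on_add Ck_on_const Ck_on_linear[OF _ bounded_linear_ident]) auto
  moreover have "(c has_vector_derivative (1, 0)) (at 0)"
    unfolding c_def by (auto intro!: derivative_eq_intros)
  ultimately show ?thesis
    using assms unfolding tangent_space_def
    by (intro CollectI exI[of _ c] exI[of _ e]) (auto simp: c_def e_def)
qed

text \<open>The defining function is \<open>(s, y) \<mapsto> |y|\<^sup>2 - r\<^sup>2\<close>, regular since its derivative in direction \<open>(0, y)\<close>
  is \<open>2 |y|\<^sup>2 = 2 r\<^sup>2\<close>.\<close>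
lemma smooth_hypersurface_cylinder:
  assumes "r > 0"
  shows "smooth_hypersurface ({-r<..<r} \<times> sphere (0 :: real ^ 'm::finite) r)"
proof -
  define U :: "'m minkowski set" where "U = {-r<..<r} \<times> UNIV"
  define F :: "'m minkowski \<Rightarrow> real" where "F x = snd x \<bullet> snd x + - r\<^sup>2" for x
  have "open U" by (simp add: U_def open_Times)
  then have "smooth_on U F"
    unfolding F_def smooth_on_def
    by (intro allI Ck_on_add Ck_on_bilinear[OF _ bounded_bilinear_inner]
        Ck_on_linear[OF _ bounded_linear_snd] Ck_on_const)
  moreover have "F x = 0 \<longleftrightarrow> norm (snd x) = r" for x
    using assms by (simp add: F_def dot_square_norm power2_eq_iff_nonneg)
  moreover have "frechet_derivative F (at x) \<noteq> (\<lambda>v. 0)" if "norm (snd x) = r" for x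
  proof -
    have "(F has_derivative (\<lambda>v. 2 * (snd x \<bullet> snd v))) (at x)"
      unfolding F_def by (auto intro!: derivative_eq_intros simp: inner_commute)
    then have "frechet_derivative F (at x) (0, snd x) = 2 * (snd x \<bullet> snd x)"
      by (simp add: frechet_derivative_at[symmetric])
    moreover have "snd x \<bullet> snd x > 0"
      using that assms by auto
    ultimately show ?thesis by auto
  qed
  ultimately show ?thesis
    unfolding smooth_hypersurface_def using \<open>open U\<close>
    by (intro ballI exI[of _ U] exI[of _ F]) (auto simp: U_def)
qed

lemma eta_eq_inner: "eta p u v = - (fst u * fst v) + snd u \<bullet> snd v"
  by (simp add: eta_def inner_vec_def)

text \<open>A normal vector is orthogonal to the tangent vector \<open>(1, 0)\<close>, which kills its time component.\<close>
lemma timelike_hypersurface_cylinder: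
  assumes "r > 0"
  shows "timelike_hypersurface ({-r<..<r} \<times> sphere (0 :: real ^ 'm::finite) r)"
  unfolding timelike_hypersurface_def
proof (intro conjI ballI allI impI smooth_hypersurface_cylinder[OF assms])
  fix p v :: "'m minkowski"
  assume p: "p \<in> {-r<..<r} \<times> sphere 0 r"
    and v: "v \<noteq> 0 \<and> (\<forall>u\<in>tangent_space ({-r<..<r} \<times> sphere 0 r) p. eta p v u = 0)"
  then have "eta p v (1, 0) = 0"
    using time_axis_tangent_cylinder by blast
  then have "fst v = 0" by (simp add: eta_eq_inner)
  moreover from this v have "snd v \<noteq> 0" by (auto simp: prod_eq_iff)
  ultimately show "eta p v v > 0" by (simp add: eta_eq_inner)
qed


section \<open>The isometry\<close>

text \<open>
  At \<open>s = r tanh t\<close> the derivative of \<open>artanh (s / r)\<close> is \<open>cosh\<^sup>2 t / r\<close>, so the factors \<open>r\<^sup>2 / cosh\<^sup>4 t\<close>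
  and \<open>r\<^sup>2\<close> of \<open>g\<close> undo exactly the two rescalings in the differential of
  \<open>(s, y) \<mapsto> (artanh (s / r), y / r)\<close>.
\<close>
lemma isometric_cylinder:
  fixes g :: "(real \<times> (real ^ 'm::finite)) metric_tensor"
  assumes r: "r > 0"
    and g: "\<And>p u v. g p u v =
           - (r\<^sup>2 / (cosh (fst p)) ^ 4) * dt_dt p u v + r\<^sup>2 * pulled_back_round_metric p u v"
  shows "isometric ({-r<..<r} \<times> sphere 0 r :: 'm minkowski set) eta line_times_sphere g"
proof -
  define M :: "'m minkowski set" where "M = {-r<..<r} \<times> sphere 0 r"
  define U :: "'m minkowski set" where "U = {-r<..<r} \<times> UNIV"
  define \<phi> :: "'m minkowski \<Rightarrow> real \<times> (real ^ 'm)"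
    where "\<phi> p = (artanh (fst p / r), snd p /\<^sub>R r)" for p
  define \<psi> :: "real \<times> (real ^ 'm) \<Rightarrow> 'm minkowski"
    where "\<psi> q = (r * tanh (fst q), r *\<^sub>R snd q)" for q
  have U: "open U" "M \<subseteq> U"
    by (auto simp: U_def M_def open_Times)
  have unit: "fst p / r \<in> {-1<..<1}" if "p \<in> U" for p
    using that r by (auto simp: U_def field_simps)

  have linear_fst: "bounded_linear (\<lambda>p :: 'm minkowski. fst p / r)"
    by (rule bounded_linear_compose[OF bounded_linear_divide bounded_linear_fst])
  have linear_snd: "bounded_linear (\<lambda>p :: 'm minkowski. c *\<^sub>R snd p)" for c
    by (rule bounded_linear_compose[OF bounded_linear_scaleR_right bounded_linear_snd])
  have "Ck_on k U (\<lambda>p. artanh (fst p / r))" for k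
    by (rule Ck_on_compose_linear[OF U(1) linear_fst _ Ck_on_artanh]) (use unit in blast)
  from Ck_on_Pair[OF U(1) this Ck_on_linear[OF U(1) linear_snd]]
  have smooth: "smooth_on U \<phi>"
    unfolding \<phi>_def smooth_on_def by (rule allI)
  have "Ck_on k UNIV (\<lambda>q :: real \<times> (real ^ 'm). tanh (fst q))" for k
    by (rule Ck_on_compose_linear[OF open_UNIV bounded_linear_fst _ Ck_on_tanh]) simp
  from Ck_on_Pair[OF open_UNIV Ck_on_mult[OF open_UNIV Ck_on_const[OF open_UNIV] this]
      Ck_on_linear[OF open_UNIV linear_snd]]
  have smooth': "smooth_on UNIV \<psi>"
    unfolding \<psi>_def smooth_on_def by (rule allI)

  have tanh_range: "r * tanh t \<in> {-r<..<r}" for t :: real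
    using range_scaled_tanh[OF r] by blast
  have maps: "\<phi> ` M \<subseteq> line_times_sphere" "\<psi> ` line_times_sphere \<subseteq> M"
    using r tanh_range by (auto simp: \<phi>_def \<psi>_def M_def line_times_sphere_def)
  have param: "\<exists>t. fst p = r * tanh t" if "p \<in> M" for p
  proof -
    have "fst p \<in> range (\<lambda>t. r * tanh t)"
      using that by (simp add: range_scaled_tanh[OF r] M_def mem_Times_iff)
    then show ?thesis by blast
  qed
  have \<psi>\<phi>: "\<psi> (\<phi> p) = p" if "p \<in> M" for p
  proof -
    obtain t where "fst p = r * tanh t" using param[OF \<open>p \<in> M\<close>] by blast
    then show ?thesis
      using r by (simp add: \<phi>_def \<psi>_def artanh_tanh_real prod_eq_iff)
  qed
  have \<phi>\<psi>: "\<phi> (\<psi> q) = q" for q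
    using r by (simp add: \<phi>_def \<psi>_def artanh_tanh_real)
  have bij: "bij_betw \<phi> M line_times_sphere"
    by (rule bij_betw_byWitness[where f' = \<psi>]) (use maps \<psi>\<phi> \<phi>\<psi> in simp_all)
  have "\<psi> q = inv_into M \<phi> q" if "q \<in> line_times_sphere" for q
    using that maps bij \<phi>\<psi> by (metis bij_betw_imp_inj_on image_subset_iff inv_into_f_f)
  then have "smooth_map line_times_sphere (inv_into M \<phi>)"
    by (intro smooth_mapI[OF _ _ smooth']) auto
  moreover have "smooth_map M \<phi>"
    by (rule smooth_mapI[OF U smooth]) simp
  ultimately have diffeo: "diffeomorphism M line_times_sphere \<phi>"
    using bij by (simp add: diffeomorphism_def)

  have "g (\<phi> p) (differential M \<phi> p u) (differential M \<phi> p v) = eta p u v"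
    if p: "p \<in> M" and uv: "u \<in> tangent_space M p" "v \<in> tangent_space M p" for p u v
  proof -
    obtain t where t: "fst p = r * tanh t" using param[OF p] by blast
    have ext: "local_smooth_extension M \<phi> p \<phi>"
      unfolding local_smooth_extension_def using U p smooth by blast
    have "(artanh has_field_derivative (cosh t)\<^sup>2) (at (fst p / r))"
      using artanh_real_has_field_derivative[of "tanh t"] t r tanh_real_bounds[of t]
      by (simp add: one_minus_tanh_square abs_less_iff)
    from DERIV_compose_FDERIV[where g = "\<lambda>p. fst p / r", OF this
        bounded_linear_imp_has_derivative[OF linear_fst]]
    have "((\<lambda>p. artanh (fst p / r)) has_derivative (\<lambda>w. fst w / r * (cosh t)\<^sup>2)) (at p)" .
    from has_derivative_Pair[OF this bounded_linear_imp_has_derivative[OF linear_snd]]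
    have "(\<phi> has_derivative (\<lambda>w. (fst w / r * (cosh t)\<^sup>2, snd w /\<^sub>R r))) (at p)"
      unfolding \<phi>_def .
    from differential_eq_derivative_of_extension[OF ext this]
    have d: "differential M \<phi> p w = (fst w / r * (cosh t)\<^sup>2, snd w /\<^sub>R r)"
      if "w \<in> tangent_space M p" for w using that .
    have "fst (\<phi> p) = t"
      using t r by (simp add: \<phi>_def artanh_tanh_real)
    moreover have "(cosh t) ^ 4 = (cosh t)\<^sup>2 * (cosh t)\<^sup>2"
      by (simp add: power_add[symmetric])
    ultimately show ?thesis
      using r unfolding g d[OF uv(1)] d[OF uv(2)] eta_eq_inner
      by (simp add: dt_dt_def pulled_back_round_metric_def round_metric_def field_simps
          power2_eq_square)
  qed
  with diffeo have "isometric M eta line_times_sphere g"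
    unfolding isometric_def by (intro exI[of _ \<phi>] conjI ballI)
  then show ?thesis by (simp add: M_def)
qed

theorem corollary3p11:
  fixes n :: nat and r :: real and \<alpha> :: "real \<Rightarrow> real"
    and g :: "(real \<times> (real ^ 'm::finite)) metric_tensor"
  assumes "n \<ge> 1" and "CARD('m) = n + 1"
    and "r > 0"
    and "\<And>t. \<alpha> t = r / cosh t"
    and "\<And>p u v. g p u v =
           - (r\<^sup>2 / (cosh (fst p)) ^ 4) * dt_dt p u v + r\<^sup>2 * pulled_back_round_metric p u v"
  shows "\<alpha> \<in> Psi_hat \<and>
    timelike_hypersurface (dS (range (h_of \<alpha>)) (f_of \<alpha>) :: 'm minkowski set) \<and>
    isometric (dS (range (h_of \<alpha>)) (f_of \<alpha>) :: 'm minkowski set) eta line_times_sphere g"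
proof -
  have \<alpha>: "\<alpha> = (\<lambda>t. r / cosh t)"
    using assms(4) by (rule ext)
  show ?thesis
    unfolding \<alpha> dS_divide_cosh[OF assms(3)]
    using divide_cosh_in_Psi_hat[OF assms(3)] timelike_hypersurface_cylinder[OF assms(3)]
      isometric_cylinder[OF assms(3,5)] by blast
qed

end
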